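(* Let $(\delta_k)_{k\ge1}$ be a monotonically decreasing sequence with $0<\delta_k<1$ and $\delta_k\to0$, and let $(\ell_k)_{k\ge1}$ be a sequence of positive numbers with $\ell_k\to+\infty$. Let $\omega$ be a modulus of continuity for which there exist constants $C',C''$ such that for all $x>0$ $$\int_{0}^{x}\frac{\omega (t)}{t}\, dt \le C' \omega (x),\qquad x\int_{x}^{\infty}\frac{\omega (t)}{t^2}\, dt\le C'' \omega (x).$$ Let $A_0=(-1,0,0)$, $B_0=(1,0,0)$, and let $[A_0,B_0]\subset\mathbb{R}^3$ be the segment joining them. Then there exists a function $f_0\in H^{\omega}([A_0,B_0])$ for which there do not exist constants $C_1',C_2'$ and functions $V_k$, $k\ge1$, with $V_k$ harmonic in $\Omega_{\ell_k\delta_k}([A_0,B_0])$, such that for all $k\ge 1$ $$|V_k(M)-f_0(M)|\le C_1'\,\omega(\delta_k)\quad\text{for all } M\in[A_0,B_0]$$ and $$|\nabla V_k(M)|\le C_2'\,\frac{\omega(\delta_k)}{\delta_k}\quad\text{for all } M\in\Omega_{\ell_k\delta_k}([A_0,B_0]).$$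
   Context: A modulus of continuity is a continuous, nondecreasing, subadditive function $\omega:[0,\infty)\to[0,\infty)$ with $\omega(0)=0$ and $\omega(t)>0$ for $t>0$. For $L\subset\mathbb{R}^3$ and $\delta>0$, $\Omega_\delta(L)=\bigcup_{M\in L}B_\delta(M)$, where $B_\delta(M)$ is the open ball in $\mathbb{R}^3$ with center $M$ and radius $\delta$. $H^\omega(L)$ is the space of all complex-valued functions $f$ on $L$ for which there is a constant $C_f$ with $|f(M_2)-f(M_1)|\le C_f\,\omega(\|M_1M_2\|)$ for all $M_1,M_2\in L$, where $\|M_1M_2\|$ is the Euclidean distance. Harmonic functions are complex-valued. *)

theory Defs
  imports "HOL-Analysis.Analysis"
begin

text \<open>Only the values of \<open>\<omega>\<close> on \<open>{0..}\<close> are relevant.\<close>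

definition modulus_of_continuity :: "(real \<Rightarrow> real) \<Rightarrow> bool" where
  "modulus_of_continuity \<omega> \<longleftrightarrow>
     continuous_on {0..} \<omega> \<and> mono_on {0..} \<omega> \<and>
     (\<forall>s\<ge>0. \<forall>t\<ge>0. \<omega> (s + t) \<le> \<omega> s + \<omega> t) \<and>
     \<omega> 0 = 0 \<and> (\<forall>t>0. \<omega> t > 0)"

definition nbhd :: "real \<Rightarrow> 'a::metric_space set \<Rightarrow> 'a set" where
  "nbhd \<delta> L = (\<Union>M\<in>L. ball M \<delta>)"

text \<open>Functions on \<open>L\<close> are represented by total functions whose values outside \<open>L\<close> play no role.\<close>

definition Holder_space :: "(real \<Rightarrow> real) \<Rightarrow> 'a::metric_space set \<Rightarrow> ('a \<Rightarrow> complex) set" where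
  "Holder_space \<omega> L = {f. \<exists>C. \<forall>M1\<in>L. \<forall>M2\<in>L. norm (f M2 - f M1) \<le> C * \<omega> (dist M1 M2)}"

definition partial_deriv :: "'n::finite \<Rightarrow> (real^'n \<Rightarrow> complex) \<Rightarrow> real^'n \<Rightarrow> complex" where
  "partial_deriv i f x = frechet_derivative f (at x) (axis i 1)"

text \<open>The norm of this vector is \<open>sqrt (\<Sum>i. |\<partial>\<^sub>i f|\<^sup>2)\<close>.\<close>

definition grad :: "(real^'n::finite \<Rightarrow> complex) \<Rightarrow> real^'n \<Rightarrow> complex^'n" where
  "grad f x = (\<chi> i. partial_deriv i f x)"

text \<open>Twice continuously differentiable with vanishing Laplacian.  Continuity of the first-order
  partial derivatives follows from their differentiability.\<close>

definition harmonic_on :: "(real^'n::finite) set \<Rightarrow> (real^'n \<Rightarrow> complex) \<Rightarrow> bool" where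
  "harmonic_on S f \<longleftrightarrow>
     open S \<and>
     (\<forall>x\<in>S. f differentiable (at x)) \<and>
     (\<forall>i. \<forall>x\<in>S. partial_deriv i f differentiable (at x)) \<and>
     (\<forall>i j. continuous_on S (partial_deriv i (partial_deriv j f))) \<and>
     (\<forall>x\<in>S. (\<Sum>i\<in>UNIV. partial_deriv i (partial_deriv i f) x) = 0)"

end

theory Submission
  imports Defs
begin

text \<open>Take \<open>f\<^sub>0 M = \<omega> \<bar>M $ 1\<bar>\<close>, whose symmetric second difference at the origin with step \<open>h\<close>
  along the segment is \<open>2 \<omega>(h)\<close>. If \<open>V\<close> is harmonic in a ball of radius \<open>R\<close> with gradient at most
  \<open>G\<close>, then its second difference with step \<open>h < R\<close> at the centre is \<open>O(G h\<^sup>2 / R)\<close>. For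
  \<open>h = m \<delta>\<^sub>k\<close>, \<open>G = O(\<omega>(\<delta>\<^sub>k) / \<delta>\<^sub>k)\<close> and \<open>R = l\<^sub>k \<delta>\<^sub>k\<close> with \<open>l\<^sub>k \<ge> m\<^sup>2\<close> this is \<open>O(\<omega>(\<delta>\<^sub>k))\<close>, so an
  approximation of \<open>f\<^sub>0\<close> within \<open>O(\<omega>(\<delta>\<^sub>k))\<close> forces \<open>\<omega>(m \<delta>\<^sub>k) = O(\<omega>(\<delta>\<^sub>k))\<close> uniformly in \<open>m\<close>. But
  the condition on \<open>\<integral>\<omega>(t)/t dt\<close> yields \<open>\<omega>(\<delta>) ln m \<le> C' \<omega>(m \<delta>)\<close>.\<close>

section \<open>Maximum principle for strictly subharmonic functions\<close>

text \<open>Since \<open>g' 0 = 0\<close> at the maximum, \<open>d > 0\<close> would make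
  \<open>g'\<close> positive just to the right of 0, and the mean value theorem would give a value
  above \<open>g 0\<close>.\<close>

lemma second_deriv_nonpos_at_local_max:
  fixes g g' :: "real \<Rightarrow> real"
  assumes der: "\<And>t. \<bar>t\<bar> < e \<Longrightarrow> (g has_real_derivative g' t) (at t)"
    and der2: "(g' has_real_derivative d) (at 0)"
    and max: "\<And>t. \<bar>t\<bar> < e \<Longrightarrow> g t \<le> g 0"
    and "e > 0"
  shows "d \<le> 0"
proof (rule ccontr)
  assume "\<not> d \<le> 0"
  then obtain e' where e': "e' > 0" "\<And>t. 0 < t \<Longrightarrow> t < e' \<Longrightarrow> g' 0 < g' t"
    using DERIV_pos_inc_right[OF der2] by auto
  have "g' 0 = 0"
    by (rule DERIV_local_max[OF der \<open>e > 0\<close>]) (use max \<open>e > 0\<close> in auto)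
  define s where "s = min e e' / 2"
  have s: "0 < s" "s < e" "s < e'"
    using e'(1) \<open>e > 0\<close> by (auto simp: s_def min_def)
  have "\<exists>z. 0 < z \<and> z < s \<and> g s - g 0 = (s - 0) * g' z"
    by (rule MVT2) (use s der in auto)
  then obtain z where z: "0 < z" "z < s" "g s - g 0 = s * g' z"
    by auto
  have "0 < g' z"
    using e'(2)[of z] z s \<open>g' 0 = 0\<close> by auto
  then have "g 0 < g s"
    using z s by (smt (verit) mult_pos_pos)
  then show False
    using max[of s] s by auto
qed

text \<open>The maximum over \<open>K\<close> cannot lie in \<open>U\<close>: there every
  \<open>p2 j\<close> would be nonpositive, against the strict inequality for their sum. Derivatives
  along coordinate lines suffice for this argument.\<close>

lemma maximum_principle:
  fixes p :: "real^'n::finite \<Rightarrow> real"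
  assumes K: "compact K" "continuous_on K p"
    and U: "open U"
    and bd: "\<And>x. x \<in> K - U \<Longrightarrow> p x \<le> 0"
    and UK: "U \<subseteq> K"
    and p1: "\<And>x j. x \<in> U \<Longrightarrow> ((\<lambda>t. p (x + t *\<^sub>R axis j 1)) has_real_derivative p1 j x) (at 0)"
    and p2: "\<And>x j. x \<in> U \<Longrightarrow> ((\<lambda>t. p1 j (x + t *\<^sub>R axis j 1)) has_real_derivative p2 j x) (at 0)"
    and pos: "\<And>x. x \<in> U \<Longrightarrow> (\<Sum>j\<in>UNIV. p2 j x) > 0"
    and x: "x \<in> K"
  shows "p x \<le> 0"
proof -
  obtain y where y: "y \<in> K" "\<And>z. z \<in> K \<Longrightarrow> p z \<le> p y"
    using continuous_attains_sup[OF K(1) _ K(2)] x by auto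
  have "y \<notin> U"
  proof
    assume yU: "y \<in> U"
    then obtain e where e: "e > 0" "ball y e \<subseteq> U"
      using U open_contains_ball by blast
    have "p2 j y \<le> 0" for j
    proof (rule second_deriv_nonpos_at_local_max[OF _ p2[OF yU] _ \<open>e > 0\<close>])
      fix t :: real assume "\<bar>t\<bar> < e"
      then have tU: "y + t *\<^sub>R axis j 1 \<in> U"
        using e(2) by (auto simp: dist_norm norm_axis_1 intro!: subsetD[OF e(2)])
      show "((\<lambda>t. p (y + t *\<^sub>R axis j 1)) has_real_derivative p1 j (y + t *\<^sub>R axis j 1)) (at t)"
        \<comment> \<open>Moving the base point to \<open>y + t *\<^sub>R axis j 1\<close> turns a
          derivative at parameter \<open>t\<close> into one at parameter 0, the only form
          assumed.\<close>
        using DERIV_shift[of "\<lambda>t. p (y + t *\<^sub>R axis j 1)" _ 0 t] p1[OF tU, of j]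
        by (simp add: algebra_simps)
      show "p (y + t *\<^sub>R axis j 1) \<le> p (y + 0 *\<^sub>R axis j 1)"
        using y(2) tU UK by auto
    qed
    then have "(\<Sum>j\<in>UNIV. p2 j y) \<le> 0"
      by (simp add: sum_nonpos)
    then show False
      using pos[OF yU] by simp
  qed
  then show ?thesis
    using bd[of y] y x by force
qed

section \<open>Derivatives and differences along coordinate lines\<close>

text \<open>The speed \<open>c\<close> covers reflected points, whose coordinate line may be
  traversed backwards.\<close>

lemma has_real_derivative_Re_line:
  fixes f :: "real^'n::finite \<Rightarrow> complex"
  assumes "f differentiable (at a)"
  shows "((\<lambda>t. Re (f (a + (c * t) *\<^sub>R axis j 1))) has_real_derivative
           c * Re (partial_deriv j f a)) (at 0)"
proof -
  let ?D = "frechet_derivative f (at a)"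
  have f: "(f has_derivative ?D) (at (a + (c * 0) *\<^sub>R axis j 1))"
    using assms frechet_derivative_works by auto
  have "((\<lambda>t. a + (c * t) *\<^sub>R axis j 1) has_derivative (\<lambda>t. (c * t) *\<^sub>R axis j 1)) (at 0)"
    by (auto intro!: derivative_eq_intros)
  from has_derivative_compose[OF this f]
  have "((\<lambda>t. Re (f (a + (c * t) *\<^sub>R axis j 1))) has_derivative
           (\<lambda>t. Re (?D ((c * t) *\<^sub>R axis j 1)))) (at 0)"
    by (rule has_derivative_Re)
  moreover have "(\<lambda>t. Re (?D ((c * t) *\<^sub>R axis j 1))) = (*) (c * Re (partial_deriv j f a))"
    using linear_frechet_derivative[OF assms]
    by (simp add: fun_eq_iff linear_cmul partial_deriv_def)
  ultimately show ?thesis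
    by (simp add: has_field_derivative_def)
qed

text \<open>The mean value theorem along the segment, which convexity keeps in \<open>S\<close>; one
  component of the gradient is bounded by its norm.\<close>

lemma Re_difference_le_grad:
  fixes V :: "real^'n::finite \<Rightarrow> complex"
  assumes "convex S"
    and diff: "\<And>y. y \<in> S \<Longrightarrow> V differentiable (at y)"
    and grad: "\<And>y. y \<in> S \<Longrightarrow> norm (grad V y) \<le> G"
    and "h > 0" "x \<in> S" "x + h *\<^sub>R axis i 1 \<in> S"
  shows "\<bar>Re (V (x + h *\<^sub>R axis i 1)) - Re (V x)\<bar> \<le> h * G"
proof -
  have in_S: "x + t *\<^sub>R axis i 1 \<in> S" if "0 \<le> t" "t \<le> h" for t
  proof -
    have "x + t *\<^sub>R axis i 1 = (1 - t / h) *\<^sub>R x + (t / h) *\<^sub>R (x + h *\<^sub>R axis i 1)"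
      using \<open>h > 0\<close> by (simp add: algebra_simps)
    then show ?thesis
      using convexD_alt[OF assms(1,5,6), of "t / h"] that \<open>h > 0\<close> by simp
  qed
  let ?g' = "\<lambda>t. Re (partial_deriv i V (x + t *\<^sub>R axis i 1))"
  have der: "((\<lambda>t. Re (V (x + t *\<^sub>R axis i 1))) has_real_derivative ?g' t) (at t)"
    if "0 \<le> t" "t \<le> h" for t
    using DERIV_shift[of "\<lambda>t. Re (V (x + t *\<^sub>R axis i 1))" _ 0 t]
      has_real_derivative_Re_line[OF diff[OF in_S[OF that]], of 1 i]
    by (simp add: algebra_simps)
  from MVT2[OF \<open>h > 0\<close> der]
  obtain z where z: "0 < z" "z < h"
    "Re (V (x + h *\<^sub>R axis i 1)) - Re (V (x + 0 *\<^sub>R axis i 1)) = (h - 0) * ?g' z"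
    by blast
  have "\<bar>?g' z\<bar> \<le> norm (grad V (x + z *\<^sub>R axis i 1) $ i)"
    by (simp add: grad_def abs_Re_le_cmod)
  also have "\<dots> \<le> G"
    using Finite_Cartesian_Product.norm_nth_le[of "grad V (x + z *\<^sub>R axis i 1)" i] grad[OF in_S[of z]] z by auto
  finally show ?thesis
    using z \<open>h > 0\<close> by (simp add: abs_mult)
qed

section \<open>Second differences of harmonic functions\<close>

text \<open>The second difference is the value at \<open>a = (h/2) e\<^sub>i\<close> of the function
  \<open>u y = (v (y + a) - v (y - a)) - (v (y' + a) - v (y' - a))\<close>, where \<open>y'\<close> is the mirror image of \<open>y\<close> in
  the hyperplane \<open>y $ i = 0\<close>. It is harmonic, vanishes on this hyperplane and is at most \<open>2 h G\<close>,
  so on the half ball of radius \<open>\<rho>\<close> it lies below \<open>2 h G\<close> times the strictly superharmonic barrier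
  \<open>\<bar>y\<bar>\<^sup>2 / \<rho>\<^sup>2 + c (s - s\<^sup>2)\<close>, where \<open>s = y $ i / \<rho>\<close> and \<open>c\<close> is the dimension plus one.\<close>

lemma harmonic_second_difference_le:
  fixes V :: "real^'n::finite \<Rightarrow> complex"
  assumes harm: "harmonic_on S V"
    and sub: "ball x R \<subseteq> S"
    and grad: "\<And>y. y \<in> ball x R \<Longrightarrow> norm (grad V y) \<le> G"
    and "G > 0" and h: "0 < h" "h < R"
  shows "Re (V (x + h *\<^sub>R axis i 1)) - 2 * Re (V x) + Re (V (x - h *\<^sub>R axis i 1))
           \<le> 2 * (real CARD('n) + 1) * G * h\<^sup>2 / R"
proof -
  \<comment> \<open>With \<open>norm a = h / 2 < R / 2\<close>, this radius keeps
    \<open>y + a\<close> and \<open>y - a\<close> within distance \<open>R\<close> of the origin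
    whenever \<open>norm y \<le> \<rho>\<close>.\<close>
  define \<rho> where "\<rho> = R / 2"
  define c where "c = real CARD('n) + 1"
  define M where "M = 2 * h * G"
  define e :: "real^'n" where "e = axis i 1"
  define a where "a = (h / 2) *\<^sub>R e"
  \<comment> \<open>The reflection \<open>r\<close> sends direction \<open>j\<close> to
    \<open>\<sigma> j\<close> times itself.\<close>
  define \<sigma> :: "'n \<Rightarrow> real" where "\<sigma> j = (if j = i then -1 else 1)" for j
  define r :: "real^'n \<Rightarrow> real^'n" where "r y = y - (2 * y $ i) *\<^sub>R e" for y
  define v where "v y = Re (V y)" for y
  define v1 where "v1 j y = Re (partial_deriv j V y)" for j y
  define v2 where "v2 j y = Re (partial_deriv j (partial_deriv j V) y)" for j y
  define u where "u y = v (x + y + a) - v (x + y - a) - v (x + r y + a) + v (x + r y - a)" for y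
  define u1 where "u1 j y = v1 j (x + y + a) - v1 j (x + y - a)
    - \<sigma> j * v1 j (x + r y + a) + \<sigma> j * v1 j (x + r y - a)" for j y
  define u2 where "u2 j y = v2 j (x + y + a) - v2 j (x + y - a)
    - v2 j (x + r y + a) + v2 j (x + r y - a)" for j y
  define b where "b y = (norm y / \<rho>)\<^sup>2 + c * (y $ i / \<rho> - (y $ i / \<rho>)\<^sup>2)" for y :: "real^'n"
  define \<kappa> :: "'n \<Rightarrow> real" where "\<kappa> j = (if j = i then 1 else 0)" for j
  define b1 where "b1 j y = 2 * y $ j / \<rho>\<^sup>2 + c * (\<kappa> j / \<rho> - 2 * \<kappa> j * y $ i / \<rho>\<^sup>2)" for j y
  define b2 where "b2 j = 2 / \<rho>\<^sup>2 - 2 * c * \<kappa> j / \<rho>\<^sup>2" for j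
  define U where "U = {y::real^'n. norm y < \<rho> \<and> y $ i > 0}"
  define K where "K = {y::real^'n. norm y \<le> \<rho> \<and> y $ i \<ge> 0}"

  have \<rho>: "\<rho> > 0" and M: "M > 0" and c: "c \<ge> 1"
    using h \<open>G > 0\<close> by (auto simp: \<rho>_def M_def c_def)
  have norm_e: "norm e = 1"
    by (simp add: e_def)
  have norm_a: "norm a = h / 2"
    using h by (simp add: a_def norm_e)
  have \<sigma>_sq: "\<sigma> j * \<sigma> j = 1" for j
    by (simp add: \<sigma>_def)
  have r_line: "r (y + t *\<^sub>R axis j 1) = r y + (\<sigma> j * t) *\<^sub>R axis j 1" for y t j
    by (auto simp: r_def \<sigma>_def e_def axis_def vec_eq_iff)
  have norm_r: "norm (r y) = norm y" for y
  proof -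
    have "(norm (r y))\<^sup>2 = (norm y)\<^sup>2"
      unfolding power2_norm_eq_inner r_def e_def
      by (simp add: inner_diff_left inner_diff_right inner_axis inner_commute[of "axis i 1"]
            algebra_simps)
    then show ?thesis
      by simp
  qed
  have near: "x + y + a \<in> ball x R" "x + y - a \<in> ball x R" if "norm y \<le> \<rho>" for y
  proof -
    have "norm (y + a) < R" "norm (y - a) < R"
      using norm_triangle_ineq[of y a] norm_triangle_ineq4[of y a] that h norm_a
      by (auto simp: \<rho>_def)
    moreover have "dist x (x + z) = norm z" for z
      by (simp add: dist_norm)
    ultimately show "x + y + a \<in> ball x R" "x + y - a \<in> ball x R"
      by (simp_all only: mem_ball add.assoc add_diff_eq[symmetric])
  qed
  \<comment> \<open>Facts 1 and 2 concern \<open>y\<close>, facts 3 and 4 its mirror image, which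
    has the same norm.\<close>
  note nearby = near near[of "r _", unfolded norm_r]

  have diff: "V differentiable (at y)" "partial_deriv j V differentiable (at y)"
    if "y \<in> ball x R" for y j
    using harm that sub by (auto simp: harmonic_on_def)
  have dv: "((\<lambda>t. v (y + (k * t) *\<^sub>R axis j 1)) has_real_derivative k * v1 j y) (at 0)"
    if "y \<in> ball x R" for y j k
    unfolding v_def v1_def by (rule has_real_derivative_Re_line[OF diff(1)[OF that]])
  have dv1: "((\<lambda>t. v1 j (y + (k * t) *\<^sub>R axis j 1)) has_real_derivative k * v2 j y) (at 0)"
    if "y \<in> ball x R" for y j k
    unfolding v1_def v2_def by (rule has_real_derivative_Re_line[OF diff(2)[OF that]])
  have lap: "(\<Sum>j\<in>UNIV. v2 j y) = 0" if "y \<in> ball x R" for y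
  proof -
    have "(\<Sum>j\<in>UNIV. partial_deriv j (partial_deriv j V) y) = 0"
      using harm that sub by (auto simp: harmonic_on_def)
    then show ?thesis
      unfolding v2_def by (metis Re_sum zero_complex.sel(1))
  qed
  have cont_v: "continuous_on (ball x R) v"
    unfolding v_def
    by (intro continuous_intros continuous_at_imp_continuous_on ballI
          differentiable_imp_continuous_within diff)
  have diff_le: "\<bar>v (x + y + a) - v (x + y - a)\<bar> \<le> h * G" if "norm y \<le> \<rho>" for y
  proof -
    have eq: "(x + y - a) + h *\<^sub>R axis i 1 = x + y + a"
      by (simp add: a_def e_def algebra_simps flip: scaleR_add_left)
    show ?thesis
      unfolding v_def
      by (rule Re_difference_le_grad[of "ball x R" V G h "x + y - a" i, unfolded eq])
        (use diff(1) grad h nearby[OF that] in auto)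
  qed

  have du: "((\<lambda>t. u (y + t *\<^sub>R axis j 1)) has_real_derivative u1 j y) (at 0)"
    if "norm y \<le> \<rho>" for y j
    using dv[OF nearby(1)[OF that], of 1 j] dv[OF nearby(2)[OF that], of 1 j]
      dv[OF nearby(3)[OF that], of "\<sigma> j" j] dv[OF nearby(4)[OF that], of "\<sigma> j" j]
    unfolding u_def u1_def r_line
    by (auto intro!: derivative_eq_intros simp: algebra_simps)
  have du1: "((\<lambda>t. u1 j (y + t *\<^sub>R axis j 1)) has_real_derivative u2 j y) (at 0)"
    if "norm y \<le> \<rho>" for y j
  proof -
    \<comment> \<open>One sign comes from the definition of \<open>u1\<close>, the other from the
      chain rule; they cancel, so \<open>u2\<close> carries no signs and the reflected terms remain
      harmonic.\<close>
    have "((\<lambda>t. u1 j (y + t *\<^sub>R axis j 1)) has_real_derivative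
       v2 j (x + y + a) - v2 j (x + y - a) - \<sigma> j * (\<sigma> j * v2 j (x + r y + a))
         + \<sigma> j * (\<sigma> j * v2 j (x + r y - a))) (at 0)"
      using dv1[OF nearby(1)[OF that], of j 1] dv1[OF nearby(2)[OF that], of j 1]
        DERIV_cmult[OF dv1[OF nearby(3)[OF that], of j "\<sigma> j"], of "\<sigma> j"]
        DERIV_cmult[OF dv1[OF nearby(4)[OF that], of j "\<sigma> j"], of "\<sigma> j"]
      unfolding u1_def r_line
      by (intro DERIV_add DERIV_diff) (simp_all add: algebra_simps)
    then show ?thesis
      by (simp add: u2_def \<sigma>_sq flip: mult.assoc)
  qed
  have sum_u2: "(\<Sum>j\<in>UNIV. u2 j y) = 0" if "norm y \<le> \<rho>" for y
    unfolding u2_def sum.distrib sum_subtractf using lap nearby[OF that] by simp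

  \<comment> \<open>The barrier is a quadratic polynomial in \<open>t\<close> along each coordinate
    line, so its derivatives can be read off.\<close>
  have b_line: "b (y + t *\<^sub>R axis j 1) = ((norm y)\<^sup>2 + 2 * t * y $ j + t\<^sup>2) / \<rho>\<^sup>2
      + c * ((y $ i + t * \<kappa> j) / \<rho> - (y $ i + t * \<kappa> j)\<^sup>2 / \<rho>\<^sup>2)" for y t j
  proof -
    have "(norm (y + t *\<^sub>R axis j 1))\<^sup>2 = (norm y)\<^sup>2 + 2 * t * y $ j + t\<^sup>2"
      unfolding power2_norm_eq_inner
      by (simp add: inner_add_left inner_add_right inner_axis inner_commute[of "axis j 1"]
            power2_eq_square algebra_simps)
    moreover have "(y + t *\<^sub>R axis j 1) $ i = y $ i + t * \<kappa> j"
      by (simp add: \<kappa>_def axis_def)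
    ultimately show ?thesis
      unfolding b_def power_divide by (simp only:)
  qed
  have db: "((\<lambda>t. b (y + t *\<^sub>R axis j 1)) has_real_derivative b1 j y) (at 0)" for y j
    unfolding b_line b1_def
    by (rule derivative_eq_intros refl | use \<rho> in \<open>simp add: field_simps power2_eq_square\<close>)+
  have b1_line: "b1 j (y + t *\<^sub>R axis j 1) = b1 j y + t * b2 j" for y t j
    using \<rho> by (auto simp: b1_def b2_def \<kappa>_def axis_def field_simps power2_eq_square)
  have db1: "((\<lambda>t. b1 j (y + t *\<^sub>R axis j 1)) has_real_derivative b2 j) (at 0)" for y j
    unfolding b1_line by (auto intro!: derivative_eq_intros)
  \<comment> \<open>The choice of \<open>c\<close> as dimension plus one makes the sum exactly
    \<open>- 2 / \<rho>\<^sup>2\<close>.\<close>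
  have sum_b2: "(\<Sum>j\<in>UNIV. b2 j) < 0"
  proof -
    have "(\<Sum>j\<in>UNIV. b2 j) = (2 * real CARD('n) - 2 * c) / \<rho>\<^sup>2"
      unfolding b2_def sum_subtractf \<kappa>_def
      by (simp add: diff_divide_distrib flip: sum_divide_distrib sum_distrib_left)
    then show ?thesis
      using \<rho> by (simp add: c_def)
  qed

  have "u a - M * b a \<le> 0"
  proof (rule maximum_principle[where K = K and U = U and p = "\<lambda>y. u y - M * b y"
        and ?p1.0 = "\<lambda>j y. u1 j y - M * b1 j y" and ?p2.0 = "\<lambda>j y. u2 j y - M * b2 j"])
    have "K = cball 0 \<rho> \<inter> {y. 0 \<le> y $ i}"
      by (auto simp: K_def)
    then show "compact K"
      by (simp add: compact_Int_closed closed_Collect_le continuous_on_component continuous_on_id)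
    have "U = ball 0 \<rho> \<inter> {y. 0 < y $ i}"
      by (auto simp: U_def)
    then show "open U"
      by (simp add: open_Int open_Collect_less continuous_on_component continuous_on_id)
    show "continuous_on K (\<lambda>y. u y - M * b y)"
      unfolding u_def b_def r_def
      by (intro continuous_intros continuous_on_compose2[OF cont_v])
        (use \<rho> nearby[unfolded r_def] in \<open>auto simp: K_def\<close>)
    show "U \<subseteq> K"
      by (auto simp: U_def K_def)
    \<comment> \<open>On the spherical part \<open>u y \<le> M\<close> and
      \<open>b y \<ge> 1\<close>; on the flat part \<open>r y = y\<close> makes \<open>u\<close>
      vanish while \<open>b y \<ge> 0\<close>.\<close>
    show "u y - M * b y \<le> 0" if "y \<in> K - U" for y
    proof -
      have y: "norm y \<le> \<rho>" "0 \<le> y $ i" "norm y = \<rho> \<or> y $ i = 0"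
        using that by (auto simp: K_def U_def)
      have s: "0 \<le> y $ i / \<rho>" "y $ i / \<rho> \<le> 1"
        using y \<rho> component_le_norm_cart[of y i] by auto
      then have "(y $ i / \<rho>)\<^sup>2 \<le> y $ i / \<rho>"
        unfolding power2_eq_square by (intro mult_left_le)
      then have b_ge: "(norm y / \<rho>)\<^sup>2 \<le> b y"
        using c by (simp add: b_def)
      show ?thesis
      proof (cases "norm y = \<rho>")
        case True
        then have "1 \<le> b y"
          using b_ge \<rho> by simp
        then have "M * 1 \<le> M * b y"
          using M by (intro mult_left_mono) auto
        moreover have "u y \<le> M"
          using diff_le[of y] diff_le[of "r y"] y(1) by (simp add: norm_r u_def M_def)
        ultimately show ?thesis
          by simp
      next
        case False
        then have "r y = y"
          using y by (simp add: r_def)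
        then have "u y = 0"
          by (simp add: u_def)
        moreover have "0 \<le> b y"
          using b_ge by (rule order_trans[rotated]) simp
        ultimately show ?thesis
          using M by simp
      qed
    qed
    fix y j assume "y \<in> U"
    then have y: "norm y \<le> \<rho>"
      by (simp add: U_def)
    show "((\<lambda>t. u (y + t *\<^sub>R axis j 1) - M * b (y + t *\<^sub>R axis j 1))
        has_real_derivative u1 j y - M * b1 j y) (at 0)"
      by (intro DERIV_diff DERIV_cmult du db y)
    show "((\<lambda>t. u1 j (y + t *\<^sub>R axis j 1) - M * b1 j (y + t *\<^sub>R axis j 1))
        has_real_derivative u2 j y - M * b2 j) (at 0)"
      by (intro DERIV_diff DERIV_cmult du1 db1 y)
  next
    fix y assume "y \<in> U"
    then have "norm y \<le> \<rho>"
      by (simp add: U_def)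
    then show "(\<Sum>j\<in>UNIV. u2 j y - M * b2 j) > 0"
      using sum_u2 sum_b2 M by (simp add: sum_subtractf mult_pos_neg flip: sum_distrib_left)
  next
    show "a \<in> K"
      using h norm_a by (simp add: K_def a_def e_def \<rho>_def axis_def)
  qed
  moreover have "M * b a \<le> M * (c * h / R)"
  proof -
    \<comment> \<open>Both \<open>norm a / \<rho>\<close> and \<open>a $ i / \<rho>\<close> equal
      \<open>h / R\<close>; the quadratic terms combine to \<open>(1 - c) * (h / R)\<^sup>2\<close>,
      which is nonpositive.\<close>
    have "b a = (h / R)\<^sup>2 + c * (h / R - (h / R)\<^sup>2)"
      using norm_a h by (simp add: b_def a_def e_def axis_def \<rho>_def)
    also have "\<dots> \<le> c * (h / R)"
      using mult_right_mono[OF c, of "(h / R)\<^sup>2"] by (simp add: algebra_simps)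
    finally show ?thesis
      using M by (intro mult_left_mono) auto
  qed
  ultimately have "u a \<le> M * (c * h / R)"
    by linarith
  \<comment> \<open>As \<open>r a = - a\<close>, the two middle terms are both
    \<open>v x\<close>.\<close>
  moreover have "u a = v (x + h *\<^sub>R e) - 2 * v x + v (x - h *\<^sub>R e)"
  proof -
    have "r a = - a"
      by (simp add: r_def a_def e_def axis_def vec_eq_iff)
    moreover have "a + a = h *\<^sub>R e"
      by (simp add: a_def flip: scaleR_add_left)
    ultimately show ?thesis
      by (simp add: u_def add.assoc)
  qed
  ultimately show ?thesis
    by (simp add: v_def e_def M_def c_def power2_eq_square mult_ac)
qed

section \<open>Estimates for the modulus of continuity\<close>

text \<open>On \<open>{d..m * d}\<close> monotonicity bounds the integrand below by
  \<open>\<omega> d / t\<close>, whose integral is \<open>\<omega> d * ln m\<close>; the rest of the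
  range contributes a nonnegative amount.\<close>

lemma modulus_times_ln_le:
  fixes \<omega> :: "real \<Rightarrow> real"
  assumes "mono_on {0..} \<omega>" "\<And>t. t > 0 \<Longrightarrow> \<omega> t \<ge> 0"
    and int: "set_integrable lborel {0<..m * d} (\<lambda>t. \<omega> t / t)"
    and "1 \<le> m" "0 < d"
  shows "\<omega> d * ln m \<le> (LBINT t:{0<..m * d}. \<omega> t / t)"
proof -
  have d: "d \<le> m * d" "0 < m * d"
    using assms by (auto simp: mult_le_cancel_right1)
  have "((\<lambda>t. \<omega> d / t) has_integral \<omega> d * ln (m * d) - \<omega> d * ln d) {d..m * d}"
    by (rule fundamental_theorem_of_calculus)
      (use d \<open>0 < d\<close> in \<open>auto simp flip: has_real_derivative_iff_has_vector_derivative
        intro!: derivative_eq_intros\<close>)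
  then have *: "integral {d..m * d} (\<lambda>t. \<omega> d / t) = \<omega> d * ln m"
    using assms by (simp add: integral_unique ln_mult algebra_simps)
  have int1: "set_integrable lborel {d..m * d} (\<lambda>t. \<omega> d / t)"
    unfolding set_integrable_def
    by (rule borel_integrable_compact) (use \<open>0 < d\<close> in \<open>auto intro!: continuous_intros\<close>)
  have "\<omega> d * ln m = (LBINT t:{d..m * d}. \<omega> d / t)"
    using set_borel_integral_eq_integral(2)[OF int1] * by simp
  also have "\<dots> \<le> (LBINT t:{0<..m * d}. \<omega> t / t)"
    using int1 int unfolding set_lebesgue_integral_def set_integrable_def
  proof (rule integral_mono)
    fix t :: real
    show "indicator {d..m * d} t *\<^sub>R (\<omega> d / t) \<le> indicator {0<..m * d} t *\<^sub>R (\<omega> t / t)"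
      using assms mono_onD[OF assms(1), of d t]
      by (auto simp: indicator_def divide_right_mono)
  qed
  finally show ?thesis .
qed

text \<open>Monotonicity and subadditivity applied to
  \<open>\<bar>M $ i\<bar> \<le> \<bar>N $ i\<bar> + dist N M\<close> give the constant 1.\<close>

lemma modulus_abs_component_in_Holder_space:
  fixes L :: "(real^'n::finite) set"
  assumes "modulus_of_continuity \<omega>"
  shows "(\<lambda>M. complex_of_real (\<omega> \<bar>M $ i\<bar>)) \<in> Holder_space \<omega> L"
proof -
  have mono: "\<And>s t. 0 \<le> s \<Longrightarrow> s \<le> t \<Longrightarrow> \<omega> s \<le> \<omega> t"
    and subadd: "\<And>s t. 0 \<le> s \<Longrightarrow> 0 \<le> t \<Longrightarrow> \<omega> (s + t) \<le> \<omega> s + \<omega> t"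
    using assms by (auto simp: modulus_of_continuity_def monotone_on_def)
  have *: "\<omega> \<bar>M $ i\<bar> - \<omega> \<bar>N $ i\<bar> \<le> \<omega> (dist N M)" for M N :: "real^'n"
  proof -
    have "\<bar>M $ i\<bar> \<le> \<bar>N $ i\<bar> + dist N M"
      using component_le_norm_cart[of "N - M" i] by (simp add: dist_norm)
    then have "\<omega> \<bar>M $ i\<bar> \<le> \<omega> (\<bar>N $ i\<bar> + dist N M)"
      by (intro mono) auto
    also have "\<dots> \<le> \<omega> \<bar>N $ i\<bar> + \<omega> (dist N M)"
      by (intro subadd) auto
    finally show ?thesis
      by simp
  qed
  have "norm (complex_of_real (\<omega> \<bar>M $ i\<bar>) - complex_of_real (\<omega> \<bar>N $ i\<bar>)) \<le> 1 * \<omega> (dist N M)"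
    for M N :: "real^'n"
    using *[of M N] *[of N M]
    by (simp add: dist_commute abs_le_iff flip: of_real_diff)
  then show ?thesis
    unfolding Holder_space_def by blast
qed

section \<open>The counterexample\<close>

theorem theorem2:
  fixes \<delta> \<l> :: "nat \<Rightarrow> real" and \<omega> :: "real \<Rightarrow> real" and C' C'' :: real and A\<^sub>0 B\<^sub>0 :: "real^3"
  assumes \<delta>_decreasing: "antimono_on {1..} \<delta>"
    and \<delta>_bounds: "\<forall>k\<ge>1. 0 < \<delta> k \<and> \<delta> k < 1"
    and \<delta>_lim: "\<delta> \<longlonglongrightarrow> 0"
    and l_pos: "\<forall>k\<ge>1. 0 < \<l> k"
    and l_lim: "filterlim \<l> at_top sequentially"
    and \<omega>_modulus: "modulus_of_continuity \<omega>"
    and \<omega>_near: "\<forall>x>0. set_integrable lborel {0<..x} (\<lambda>t. \<omega> t / t) \<and>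
                     (LBINT t:{0<..x}. \<omega> t / t) \<le> C' * \<omega> x"
    and \<omega>_far: "\<forall>x>0. set_integrable lborel {x..} (\<lambda>t. \<omega> t / t^2) \<and>
                    x * (LBINT t:{x..}. \<omega> t / t^2) \<le> C'' * \<omega> x"
    and A\<^sub>0: "A\<^sub>0 = vector [-1, 0, 0]"
    and B\<^sub>0: "B\<^sub>0 = vector [1, 0, 0]"
  shows "\<exists>f\<^sub>0 \<in> Holder_space \<omega> (closed_segment A\<^sub>0 B\<^sub>0).
           \<not> (\<exists>(C\<^sub>1 :: real) (C\<^sub>2 :: real) (V :: nat \<Rightarrow> real^3 \<Rightarrow> complex).
                \<forall>k\<ge>1.
                  harmonic_on (nbhd (\<l> k * \<delta> k) (closed_segment A\<^sub>0 B\<^sub>0)) (V k) \<and>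
                  (\<forall>M \<in> closed_segment A\<^sub>0 B\<^sub>0. norm (V k M - f\<^sub>0 M) \<le> C\<^sub>1 * \<omega> (\<delta> k)) \<and>
                  (\<forall>M \<in> nbhd (\<l> k * \<delta> k) (closed_segment A\<^sub>0 B\<^sub>0).
                     norm (grad (V k) M) \<le> C\<^sub>2 * (\<omega> (\<delta> k) / \<delta> k)))"
proof (rule bexI)
  define f\<^sub>0 :: "real^3 \<Rightarrow> complex" where "f\<^sub>0 M = complex_of_real (\<omega> \<bar>M $ 1\<bar>)" for M
  define L where "L = closed_segment A\<^sub>0 B\<^sub>0"
  define e :: "real^3" where "e = axis 1 1"
  show "f\<^sub>0 \<in> Holder_space \<omega> (closed_segment A\<^sub>0 B\<^sub>0)"
    unfolding f\<^sub>0_def by (rule modulus_abs_component_in_Holder_space[OF \<omega>_modulus])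
  have in_L: "t *\<^sub>R e \<in> L" if "\<bar>t\<bar> \<le> 1" for t
  proof -
    have "t *\<^sub>R e = (1 - (t + 1) / 2) *\<^sub>R A\<^sub>0 + ((t + 1) / 2) *\<^sub>R B\<^sub>0"
      by (simp add: A\<^sub>0 B\<^sub>0 e_def vec_eq_iff forall_3 axis_def field_simps)
    then show ?thesis
      unfolding L_def in_segment using that by (intro exI[of _ "(t + 1) / 2"]) auto
  qed
  show "\<not> (\<exists>(C\<^sub>1 :: real) (C\<^sub>2 :: real) (V :: nat \<Rightarrow> real^3 \<Rightarrow> complex).
                \<forall>k\<ge>1.
                  harmonic_on (nbhd (\<l> k * \<delta> k) (closed_segment A\<^sub>0 B\<^sub>0)) (V k) \<and>
                  (\<forall>M \<in> closed_segment A\<^sub>0 B\<^sub>0. norm (V k M - f\<^sub>0 M) \<le> C\<^sub>1 * \<omega> (\<delta> k)) \<and>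
                  (\<forall>M \<in> nbhd (\<l> k * \<delta> k) (closed_segment A\<^sub>0 B\<^sub>0).
                     norm (grad (V k) M) \<le> C\<^sub>2 * (\<omega> (\<delta> k) / \<delta> k)))"
  proof (rule notI, elim exE)
    fix C\<^sub>1 C\<^sub>2 :: real and V :: "nat \<Rightarrow> real^3 \<Rightarrow> complex"
    assume V: "\<forall>k\<ge>1. harmonic_on (nbhd (\<l> k * \<delta> k) (closed_segment A\<^sub>0 B\<^sub>0)) (V k) \<and>
                  (\<forall>M \<in> closed_segment A\<^sub>0 B\<^sub>0. norm (V k M - f\<^sub>0 M) \<le> C\<^sub>1 * \<omega> (\<delta> k)) \<and>
                  (\<forall>M \<in> nbhd (\<l> k * \<delta> k) (closed_segment A\<^sub>0 B\<^sub>0).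
                     norm (grad (V k) M) \<le> C\<^sub>2 * (\<omega> (\<delta> k) / \<delta> k))"
    \<comment> \<open>The second difference bound requires a positive gradient bound, whatever the
      sign of \<open>C\<^sub>2\<close>.\<close>
    define D where "D = \<bar>C\<^sub>2\<bar> + 1"
    \<comment> \<open>Half of \<open>4 * C\<^sub>1 + 8 * D\<close>: the approximation errors at
      \<open>h\<close>, at \<open>- h\<close> and twice at 0, plus the harmonic bound with
      \<open>2 * (3 + 1) = 8\<close>.\<close>
    define B where "B = 2 * C\<^sub>1 + 4 * D"
    \<comment> \<open>Chosen so that \<open>ln m\<close> exceeds by 1 the bound
      \<open>\<bar>C'\<bar> * \<bar>B\<bar>\<close> reached at the end.\<close>
    define m where "m = exp (\<bar>C'\<bar> * \<bar>B\<bar> + 1)"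
    have m: "m > 1"
      by (simp add: m_def add_nonneg_pos)
    \<comment> \<open>The condition on \<open>\<l> k\<close> gives both \<open>h < R\<close> and
      \<open>m\<^sup>2 / \<l> k \<le> 1\<close>; the one on \<open>\<delta> k\<close> keeps the
      points at \<open>h\<close> and \<open>- h\<close> on the segment.\<close>
    have "eventually (\<lambda>k. k \<ge> 1 \<and> \<l> k \<ge> m\<^sup>2 \<and> \<delta> k < 1 / m) sequentially"
      using l_lim order_tendstoD(2)[OF \<delta>_lim, of "1 / m"] m
      by (auto simp: filterlim_at_top intro!: eventually_conj eventually_ge_at_top)
    then obtain k where k: "k \<ge> 1" "\<l> k \<ge> m\<^sup>2" "\<delta> k < 1 / m"
      unfolding eventually_sequentially by blast
    define d where "d = \<delta> k"
    define h where "h = m * d"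
    define R where "R = \<l> k * d"
    define w where "w = \<omega> d"
    have d: "0 < d" and h: "0 < h" "h \<le> 1"
      using k \<delta>_bounds m by (auto simp: d_def h_def field_simps)
    have w: "0 < w" and \<omega>_pos: "\<And>t. t > 0 \<Longrightarrow> \<omega> t > 0" and \<omega>0: "\<omega> 0 = 0" and mono: "mono_on {0..} \<omega>"
      using \<omega>_modulus d by (auto simp: modulus_of_continuity_def w_def)
    have "m < m\<^sup>2"
      using m by (simp add: power2_eq_square)
    then have hR: "h < R"
      using k d by (simp add: h_def R_def)
    have harm: "harmonic_on (nbhd R L) (V k)"
      and appr: "\<And>M. M \<in> L \<Longrightarrow> norm (V k M - f\<^sub>0 M) \<le> C\<^sub>1 * w"
      and grad_V: "\<And>M. M \<in> nbhd R L \<Longrightarrow> norm (grad (V k) M) \<le> C\<^sub>2 * (w / d)"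
      using V k(1) by (auto simp: R_def L_def w_def d_def)
    have sub: "ball 0 R \<subseteq> nbhd R L"
      using in_L[of 0] by (auto simp: nbhd_def)
    have "C\<^sub>2 * (w / d) \<le> D * (w / d)"
      by (rule mult_right_mono) (use w d in \<open>auto simp: D_def\<close>)
    then have "norm (grad (V k) y) \<le> D * (w / d)" if "y \<in> ball 0 R" for y
      using grad_V[of y] sub that by auto
    then have "Re (V k (0 + h *\<^sub>R axis 1 1)) - 2 * Re (V k 0) + Re (V k (0 - h *\<^sub>R axis 1 1))
        \<le> 2 * (real CARD(3) + 1) * (D * (w / d)) * h\<^sup>2 / R"
      by (rule harmonic_second_difference_le[OF harm sub])
        (use w d h hR in \<open>auto simp: D_def\<close>)
    also have "\<dots> = 8 * D * w * (m\<^sup>2 / \<l> k)"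
      using d by (simp add: h_def R_def power2_eq_square)
    also have "\<dots> \<le> 8 * D * w"
    proof -
      have "0 < \<l> k"
        using l_pos k(1) by auto
      then have "m\<^sup>2 / \<l> k \<le> 1"
        using k(2) by simp
      then show ?thesis
        by (rule mult_left_le) (use w in \<open>simp add: D_def\<close>)
    qed
    finally have V_diff: "Re (V k (h *\<^sub>R e)) - 2 * Re (V k 0) + Re (V k ((- h) *\<^sub>R e)) \<le> 8 * D * w"
      by (simp add: e_def)
    have Re_appr: "\<bar>Re (V k (t *\<^sub>R e)) - \<omega> \<bar>t\<bar>\<bar> \<le> C\<^sub>1 * w" if "\<bar>t\<bar> \<le> 1" for t
      using appr[OF in_L[OF that]] abs_Re_le_cmod[of "V k (t *\<^sub>R e) - f\<^sub>0 (t *\<^sub>R e)"]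
      by (simp add: f\<^sub>0_def e_def axis_def)
    have "2 * \<omega> h \<le> 4 * C\<^sub>1 * w + 8 * D * w"
      using Re_appr[of h] Re_appr[of "- h"] Re_appr[of 0] V_diff h \<omega>0 by simp
    then have \<omega>h: "\<omega> h \<le> B * w"
      by (simp add: B_def algebra_simps)
    have "w * ln m \<le> (LBINT t:{0<..m * d}. \<omega> t / t)"
      unfolding w_def
      by (rule modulus_times_ln_le[OF mono])
        (use \<omega>_pos \<omega>_near m d h in \<open>auto simp: h_def less_imp_le\<close>)
    also have "\<dots> \<le> C' * \<omega> h"
      using \<omega>_near h by (simp add: h_def)
    also have "\<dots> \<le> \<bar>C'\<bar> * (\<bar>B\<bar> * w)"
    proof (rule mult_mono)
      have "B * w \<le> \<bar>B\<bar> * w"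
        using w by (intro mult_right_mono) auto
      then show "\<omega> h \<le> \<bar>B\<bar> * w"
        using \<omega>h by simp
    qed (use \<omega>_pos[OF h(1)] in auto)
    finally have "ln m \<le> \<bar>C'\<bar> * \<bar>B\<bar>"
      using w by (simp add: mult.assoc[symmetric] mult.commute[of w])
    then show False
      by (simp add: m_def)
  qed
qed

end
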